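(* Let $N_r\ge 1$ be an integer and $\eta>0$. Let $\mathbf{g}_i$, $\mathbf{g}_j$ be random vectors in $\mathbb{C}^{N_r}$, each distributed as $\mathcal{CN}(\mathbf{0},\eta\mathbf{I}_{N_r})$, and let $\mathbf{h}_k$ be a random vector in $\mathbb{C}^{N_r}$ that is almost surely nonzero. If $i\neq j$, assume $\mathbf{g}_i,\mathbf{g}_j,\mathbf{h}_k$ are mutually independent; if $i=j$, then $\mathbf{g}_i=\mathbf{g}_j$ is a single vector, assumed independent of $\mathbf{h}_k$. Put $\phi_1=\angle\,\mathbf{g}_j^H\mathbf{h}_k$ and $\phi_2=\angle\,\mathbf{g}_i^H\mathbf{h}_k$. Then $$\mathbb{E}\left\{\mathbf{g}_i^H\mathbf{g}_j\, e^{\mathrm{j}(\phi_1-\phi_2)}\right\}=\begin{cases}\frac{\pi\eta}{4} & i\neq j,\\ \eta N_r & i=j,\end{cases}$$ where $\mathrm{j}$ in the exponent is the imaginary unit.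
   Context: $\mathcal{CN}(\mathbf{0},\eta\mathbf{I})$ is the circularly symmetric complex Gaussian distribution with covariance $\eta\mathbf{I}$: entries are independent, each with independent real and imaginary parts of law $\mathcal{N}(0,\eta/2)$. $(\cdot)^H$ is the conjugate transpose, and $\angle z$ is the phase (argument) of a nonzero complex number $z$. *)

theory Defs
  imports "HOL-Probability.Probability"
begin

definition herm_prod :: "complex ^ 'n \<Rightarrow> complex ^ 'n \<Rightarrow> complex"
  where "herm_prod u v = (\<Sum>m\<in>UNIV. cnj (u $ m) * v $ m)"

(* X has law CN(0, eta I) under M.  The second parameter of normal_density is the
   standard deviation, so sqrt (eta / 2) gives variance eta / 2. *)
definition circ_gaussian :: "'a measure \<Rightarrow> real \<Rightarrow> ('a \<Rightarrow> complex ^ 'n) \<Rightarrow> bool"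
  where "circ_gaussian M \<eta> X \<longleftrightarrow>
    X \<in> borel_measurable M \<and>
    prob_space.indep_vars M (\<lambda>_. borel) (\<lambda>m \<omega>. X \<omega> $ m) UNIV \<and>
    (\<forall>m. prob_space.indep_var M borel (\<lambda>\<omega>. Re (X \<omega> $ m)) borel (\<lambda>\<omega>. Im (X \<omega> $ m)) \<and>
         distributed M lborel (\<lambda>\<omega>. Re (X \<omega> $ m)) (normal_density 0 (sqrt (\<eta> / 2))) \<and>
         distributed M lborel (\<lambda>\<omega>. Im (X \<omega> $ m)) (normal_density 0 (sqrt (\<eta> / 2))))"

end

theory Submission
  imports Defs
begin

text \<open>
  For $i \neq j$, condition on the value $x$ of $h_k$. By independence the expectation is
  $\langle a, a \rangle$, where $a$ is the mean of $g\, e^{\mathrm{j} \angle g^H x}$. To find $a$ without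
  invoking unitary invariance, average over rotations: $|z|$ is half the integral of
  $|\mathrm{Re}(e^{-\mathrm{j}t} z)|$ over an interval of length $\pi$, and $\mathrm{Re}(g^H y)$ is a real
  Gaussian, so that $E|g^H y| = c \|y\|$ with $c = \sqrt{\pi\eta}/2$. Since
  $|g^H y| \geq \mathrm{Re}(e^{-\mathrm{j} \angle g^H x} g^H y)$ with equality at $y = x$, taking means
  gives $\mathrm{Re}\langle a, y \rangle \leq c \|y\|$ with equality at $y = x$; hence $a = c x / \|x\|$.
\<close>

section \<open>The modulus of a complex number as an average over rotations\<close>

lemma abs_cos_has_integral:
  "((\<lambda>t. \<bar>cos (t - x)\<bar>) has_integral 2) {- (pi / 2)..pi / 2}" if "0 \<le> x" "x \<le> pi" for x :: real
proof -
  \<comment> \<open>For \<open>x\<close> in [0, pi] the cosine can change sign inside the interval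
    only at \<open>x - pi / 2\<close>, so the integral is split there: the integrand is -cos before
    that point and cos after it.\<close>
  have 1: "((\<lambda>t. - cos (t - x)) has_integral (- sin (x - pi / 2 - x) - - sin (- (pi / 2) - x))) {- (pi / 2)..x - pi / 2}"
    using that
    by (intro fundamental_theorem_of_calculus)
       (auto intro!: derivative_eq_intros simp flip: has_real_derivative_iff_has_vector_derivative)
  have 2: "((\<lambda>t. cos (t - x)) has_integral (sin (pi / 2 - x) - sin (x - pi / 2 - x))) {x - pi / 2..pi / 2}"
    using that
    by (intro fundamental_theorem_of_calculus)
       (auto intro!: derivative_eq_intros simp flip: has_real_derivative_iff_has_vector_derivative)
  have I1: "((\<lambda>t. \<bar>cos (t - x)\<bar>) has_integral (- sin (x - pi / 2 - x) - - sin (- (pi / 2) - x))) {- (pi / 2)..x - pi / 2}"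
  proof (rule has_integral_eq[OF _ 1])
    fix t assume "t \<in> {- (pi / 2)..x - pi / 2}"
    then have "cos (t - x + pi) \<ge> 0"
      using that by (intro cos_ge_zero) auto
    then show "- cos (t - x) = \<bar>cos (t - x)\<bar>" by simp
  qed
  have I2: "((\<lambda>t. \<bar>cos (t - x)\<bar>) has_integral (sin (pi / 2 - x) - sin (x - pi / 2 - x))) {x - pi / 2..pi / 2}"
  proof (rule has_integral_eq[OF _ 2])
    fix t assume "t \<in> {x - pi / 2..pi / 2}"
    then have "cos (t - x) \<ge> 0"
      using that by (intro cos_ge_zero) auto
    then show "cos (t - x) = \<bar>cos (t - x)\<bar>" by simp
  qed
  have s: "sin (- (pi / 2) - x) = - cos x" "sin (pi / 2 - x) = cos x"
    by (simp_all add: sin_diff)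
  show ?thesis
    using has_integral_combine[OF _ _ I1 I2] that by (simp add: s)
qed

lemma norm_has_integral_abs_Re:
  "((\<lambda>t. \<bar>Re (cis (- t) * z)\<bar>) has_integral 2 * cmod z) {- (pi / 2)..pi / 2}"
proof -
  \<comment> \<open>\<open>Arg z\<close> ranges over (-pi, pi]. Adding pi to a negative argument
    only flips the sign of the cosine, which the absolute value absorbs, and brings \<open>x\<close>
    into [0, pi].\<close>
  define x where "x = (if 0 \<le> Arg z then Arg z else Arg z + pi)"
  have x: "0 \<le> x" "x \<le> pi"
    using Arg_bounded[of z] by (auto simp: x_def)
  have "\<bar>Re (cis (- t) * z)\<bar> = cmod z * \<bar>cos (t - x)\<bar>" for t
  proof -
    have "cis (- t) * z = of_real (cmod z) * cis (Arg z - t)"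
      by (subst (1) rcis_cmod_Arg[of z, symmetric]) (simp add: rcis_def cis_mult)
    then have "\<bar>Re (cis (- t) * z)\<bar> = cmod z * \<bar>cos (Arg z - t)\<bar>"
      by (simp add: abs_mult)
    also have "\<bar>cos (Arg z - t)\<bar> = \<bar>cos (t - x)\<bar>"
      by (auto simp: x_def cos_diff cos_add sin_add algebra_simps abs_if)
    finally show ?thesis .
  qed
  with has_integral_mult_right[OF abs_cos_has_integral[OF x], of "cmod z"] show ?thesis
    by (simp add: mult.commute)
qed

section \<open>Measurability and elementary facts on complex vectors\<close>

lemma herm_prod_measurable [measurable]:
  assumes [measurable]: "f \<in> borel_measurable M" "g \<in> borel_measurable M"
  shows "(\<lambda>\<omega>. herm_prod (f \<omega>) (g \<omega>)) \<in> borel_measurable M"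
proof -
  have "continuous_on UNIV (\<lambda>p. herm_prod (fst p) (snd p))"
    unfolding herm_prod_def by (intro continuous_intros)
  from borel_measurable_continuous_on[OF this borel_measurable_Pair[OF assms]] show ?thesis by simp
qed

lemma vec_nth_borel_measurable [measurable]:
  fixes f :: "'a \<Rightarrow> 'b::real_normed_vector ^ 'n"
  assumes [measurable]: "f \<in> borel_measurable M"
  shows "(\<lambda>\<omega>. f \<omega> $ m) \<in> borel_measurable M"
  by (rule borel_measurable_continuous_on[OF _ assms]) (intro continuous_intros)

text \<open>\<open>Arg\<close> jumps on the negative real axis, but off the origin the phase factor
  is the continuous map z / |z|. At 0 the default \<open>Arg 0 = 0\<close> gives the value 1 rather
  than \<open>sgn 0 = 0\<close>, hence the case split.\<close>

lemma cis_Arg_measurable [measurable]: "(\<lambda>z. cis (Arg z)) \<in> borel_measurable borel"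
proof -
  have "(\<lambda>z. cis (Arg z)) = (\<lambda>z. if z = 0 then 1 else z /\<^sub>R cmod z)"
    by (auto simp: fun_eq_iff cis_Arg sgn_div_norm Arg_zero)
  also have "\<dots> \<in> borel_measurable borel" by measurable
  finally show ?thesis .
qed

lemma cnj_borel_measurable [measurable]: "cnj \<in> borel_measurable borel"
  by (intro borel_measurable_continuous_onI continuous_intros)

text \<open>Links the Hermitian product to the real inner product space in which the extremal
  argument of \<open>phase_mean\<close> takes place.\<close>

lemma inner_complex_vec: "inner v w = Re (herm_prod v w)"
  by (simp add: inner_vec_def herm_prod_def inner_complex_def)

lemma char_scale:
  assumes [measurable]: "X \<in> borel_measurable M"
  shows "char (distr M borel (\<lambda>\<omega>. a * X \<omega>)) t = char (distr M borel X) (a * t)"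
  by (simp add: char_def integral_distr mult_ac)

lemma norm_vec_power2: "(norm (w :: complex ^ 'n))\<^sup>2 = (\<Sum>m\<in>UNIV. (cmod (w $ m))\<^sup>2)"
  by (simp add: norm_vec_def L2_set_def sum_nonneg)

section \<open>Moments of Gaussian vectors and of their projections\<close>

context prob_space
begin

lemma char_distr_normal:
  assumes X: "distributed M lborel X (normal_density 0 \<sigma>)" and "\<sigma> > 0"
  shows "char (distr M borel X) t = exp (- (\<sigma> * t)\<^sup>2 / 2)"
proof -
  have [measurable]: "X \<in> borel_measurable M"
    using distributed_measurable[OF X] by simp
  have "distributed M lborel (\<lambda>\<omega>. X \<omega> / \<sigma>) std_normal_density"
    using normal_standard_normal_convert[OF \<open>\<sigma> > 0\<close>, of X 0] X by simp
  then have "distr M lborel (\<lambda>\<omega>. X \<omega> / \<sigma>) = std_normal_distribution"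
    by (rule distributed_distr_eq_density)
  \<comment> \<open>\<open>distributed\<close> fixes the law on \<open>lborel\<close>, while the
    claim is about the law on \<open>borel\<close>; both have the same measurable sets.\<close>
  moreover have "distr M borel (\<lambda>\<omega>. X \<omega> / \<sigma>) = distr M lborel (\<lambda>\<omega>. X \<omega> / \<sigma>)"
    by (rule distr_cong) auto
  ultimately have "char (distr M borel (\<lambda>\<omega>. X \<omega> / \<sigma>)) (\<sigma> * t) = exp (- (\<sigma> * t)\<^sup>2 / 2)"
    by (simp add: char_std_normal_distribution)
  moreover have "char (distr M borel X) t = char (distr M borel (\<lambda>\<omega>. X \<omega> / \<sigma>)) (\<sigma> * t)"
    using \<open>\<sigma> > 0\<close> char_scale[of X M "1 / \<sigma>" "\<sigma> * t"] by simp
  ultimately show ?thesis by simp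
qed

text \<open>By Levy uniqueness the law is that of \<sigma> times a standard normal variable.
  Assuming the characteristic function instead of a density admits \<sigma> = 0, which occurs when a
  Gaussian vector is projected on the zero vector.\<close>

lemma abs_normal_moment:
  assumes [measurable]: "X \<in> borel_measurable M" and "\<sigma> \<ge> 0"
    and ch: "\<And>t. char (distr M borel X) t = exp (- (\<sigma> * t)\<^sup>2 / 2)"
  shows "has_bochner_integral M (\<lambda>\<omega>. \<bar>X \<omega>\<bar>) (\<sigma> * sqrt (2 / pi))"
proof -
  interpret N: real_distribution std_normal_distribution by (rule real_dist_normal_dist)
  have d: "distr M borel X = distr std_normal_distribution borel (\<lambda>x. \<sigma> * x)"
  proof (rule Levy_uniqueness)
    have "char (distr std_normal_distribution borel (\<lambda>x. \<sigma> * x)) t = exp (- (\<sigma> * t)\<^sup>2 / 2)" for t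
    proof -
      have "distr std_normal_distribution borel (\<lambda>x. x) = std_normal_distribution"
        by (rule distr_id2) simp
      then show ?thesis
        using char_scale[of "\<lambda>x. x" std_normal_distribution \<sigma> t]
        by (simp add: char_std_normal_distribution)
    qed
    then show "char (distr M borel X) = char (distr std_normal_distribution borel (\<lambda>x. \<sigma> * x))"
      by (simp add: fun_eq_iff ch)
  qed (auto intro!: N.real_distribution_distr real_distribution_distr)
  \<comment> \<open>Index 0 of the odd absolute moments is the first one.\<close>
  have m: "has_bochner_integral std_normal_distribution (\<lambda>x. \<bar>x\<bar>) (sqrt (2 / pi))"
    using std_normal_moment_abs_odd[of 0]
    by (subst has_bochner_integral_density) (auto simp: normal_density_nonneg)
  have "has_bochner_integral (distr std_normal_distribution borel (\<lambda>x. \<sigma> * x)) (\<lambda>x. \<bar>x\<bar>) (\<sigma> * sqrt (2 / pi))"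
    using has_bochner_integral_mult_right[OF m, of \<sigma>] \<open>\<sigma> \<ge> 0\<close>
    by (subst has_bochner_integral_distr) (auto simp: abs_mult)
  then show ?thesis
    by (simp add: d[symmetric] has_bochner_integral_iff integrable_distr_eq integral_distr)
qed

text \<open>The projection is a linear combination of independent real Gaussians, so the
  characteristic functions multiply, first over the real and imaginary part of a coordinate and then
  over the coordinates.\<close>

lemma char_Re_herm_prod:
  assumes G: "circ_gaussian M \<eta> X" and "\<eta> > 0"
  shows "char (distr M borel (\<lambda>\<omega>. Re (herm_prod (X \<omega>) w))) t
    = exp (- (sqrt (\<eta> / 2) * norm w * t)\<^sup>2 / 2)"
proof -
  have [measurable]: "X \<in> borel_measurable M"
    using G by (simp add: circ_gaussian_def)
  have ind: "indep_vars (\<lambda>_. borel) (\<lambda>m \<omega>. X \<omega> $ m) UNIV"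
    using G by (simp add: circ_gaussian_def)
  have "indep_vars (\<lambda>_. borel) (\<lambda>m \<omega>. (\<lambda>z. Re (w $ m) * Re z + Im (w $ m) * Im z) (X \<omega> $ m)) UNIV"
    by (rule indep_vars_compose2[OF ind]) measurable
  note sum = char_distr_sum[OF this, of t]
  \<comment> \<open>The two parts have variance \<eta>/2 and weights Re(w_m) and Im(w_m), so the
    variance of their combination is (\<eta>/2) |w_m|^2; the half in the Gaussian exponent turns
    this into \<eta>/4.\<close>
  have each: "char (distr M borel (\<lambda>\<omega>. Re (w $ m) * Re (X \<omega> $ m) + Im (w $ m) * Im (X \<omega> $ m))) t
      = exp (- \<eta> / 4 * t\<^sup>2 * (cmod (w $ m))\<^sup>2)" for m
  proof -
    have d: "distributed M lborel (\<lambda>\<omega>. Re (X \<omega> $ m)) (normal_density 0 (sqrt (\<eta> / 2)))"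
        "distributed M lborel (\<lambda>\<omega>. Im (X \<omega> $ m)) (normal_density 0 (sqrt (\<eta> / 2)))"
      and i: "indep_var borel (\<lambda>\<omega>. Re (X \<omega> $ m)) borel (\<lambda>\<omega>. Im (X \<omega> $ m))"
      using G by (auto simp: circ_gaussian_def)
    have "indep_var borel (\<lambda>\<omega>. Re (w $ m) * Re (X \<omega> $ m)) borel (\<lambda>\<omega>. Im (w $ m) * Im (X \<omega> $ m))"
      using indep_var_compose[OF i, of "(*) (Re (w $ m))" borel "(*) (Im (w $ m))" borel]
      by (simp add: comp_def)
    then show ?thesis
      using \<open>\<eta> > 0\<close>
      by (simp add: char_distr_add char_scale char_distr_normal[OF d(1)] char_distr_normal[OF d(2)]
          power_mult_distrib cmod_power2 ring_distribs flip: of_real_mult exp_add)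
         (simp add: algebra_simps)
  qed
  have "Re (herm_prod (X \<omega>) w) = (\<Sum>m\<in>UNIV. Re (w $ m) * Re (X \<omega> $ m) + Im (w $ m) * Im (X \<omega> $ m))" for \<omega>
    by (simp add: herm_prod_def mult.commute)
  with sum show ?thesis
    using \<open>\<eta> > 0\<close>
    by (simp add: each norm_vec_power2 power_mult_distrib flip: of_real_prod exp_sum)
       (simp add: sum_negf sum_distrib_left sum_distrib_right sum_divide_distrib mult_ac)
qed

lemma Re_herm_prod_mean:
  assumes G: "circ_gaussian M \<eta> X" and "\<eta> > 0"
  shows "has_bochner_integral M (\<lambda>\<omega>. \<bar>Re (herm_prod (X \<omega>) w)\<bar>) (sqrt (\<eta> / pi) * norm w)"
proof -
  have [measurable]: "X \<in> borel_measurable M"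
    using G by (simp add: circ_gaussian_def)
  have "has_bochner_integral M (\<lambda>\<omega>. \<bar>Re (herm_prod (X \<omega>) w)\<bar>) (sqrt (\<eta> / 2) * norm w * sqrt (2 / pi))"
    using \<open>\<eta> > 0\<close> by (intro abs_normal_moment char_Re_herm_prod[OF G]) auto
  moreover have "sqrt (\<eta> / 2) * norm w * sqrt (2 / pi) = sqrt (\<eta> / pi) * norm w"
    by (simp add: real_sqrt_divide)
  ultimately show ?thesis by simp
qed

lemma norm_herm_prod_mean:
  assumes G: "circ_gaussian M \<eta> X" and "\<eta> > 0"
  shows "has_bochner_integral M (\<lambda>\<omega>. cmod (herm_prod (X \<omega>) w)) (sqrt (pi * \<eta>) / 2 * norm w)"
proof -
  have [measurable]: "X \<in> borel_measurable M"
    using G by (simp add: circ_gaussian_def)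
  interpret P: pair_sigma_finite M lborel
    by (simp add: pair_sigma_finite_def prob_space_imp_sigma_finite sigma_finite_lborel prob_space_axioms)
  have cis [measurable]: "cis \<in> borel_measurable borel"
    by (intro borel_measurable_continuous_onI continuous_intros)
  \<comment> \<open>Rotating the product amounts to rotating \<open>w\<close>, which keeps its norm;
    hence the mean is the same for every angle.\<close>
  have rot: "(\<integral>\<^sup>+\<omega>. ennreal \<bar>Re (cis (- t) * herm_prod (X \<omega>) w)\<bar> \<partial>M) = ennreal (sqrt (\<eta> / pi) * norm w)" for t
  proof -
    have "cis (- t) * herm_prod (X \<omega>) w = herm_prod (X \<omega>) (cis (- t) *s w)" for \<omega>
      by (simp add: herm_prod_def sum_distrib_left mult_ac)
    moreover have "norm (cis (- t) *s w) = norm w"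
      by (simp add: norm_vec_def norm_mult)
    ultimately show ?thesis
      using Re_herm_prod_mean[OF assms, of "cis (- t) *s w"]
      by (simp add: nn_integral_eq_integral has_bochner_integral_iff)
  qed
  \<comment> \<open>With nonnegative integrals the exchange of order requires measurability only;
    integrability of the modulus then follows from the finite value. The factor pi that appears is
    the length of the interval of angles.\<close>
  have "(\<integral>\<^sup>+\<omega>. ennreal (2 * cmod (herm_prod (X \<omega>) w)) \<partial>M)
      = (\<integral>\<^sup>+\<omega>. \<integral>\<^sup>+t. ennreal \<bar>Re (cis (- t) * herm_prod (X \<omega>) w)\<bar> * indicator {- (pi / 2)..pi / 2} t \<partial>lborel \<partial>M)"
    by (intro nn_integral_cong nn_integral_has_integral_lebesgue'[symmetric] norm_has_integral_abs_Re) auto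
  also have "\<dots> = (\<integral>\<^sup>+t. \<integral>\<^sup>+\<omega>. ennreal \<bar>Re (cis (- t) * herm_prod (X \<omega>) w)\<bar> * indicator {- (pi / 2)..pi / 2} t \<partial>M \<partial>lborel)"
    by (rule P.Fubini'[symmetric]) measurable
  also have "\<dots> = (\<integral>\<^sup>+t. ennreal (sqrt (\<eta> / pi) * norm w) * indicator {- (pi / 2)..pi / 2} t \<partial>lborel)"
    by (intro nn_integral_cong) (simp add: nn_integral_multc rot del: times_complex.sel)
  also have "\<dots> = ennreal (sqrt (\<eta> / pi) * norm w * pi)"
    using \<open>\<eta> > 0\<close> by (simp add: nn_integral_cmult_indicator ennreal_mult)
  also have "sqrt (\<eta> / pi) * norm w * pi = sqrt (pi * \<eta>) * norm w"
    using \<open>\<eta> > 0\<close> by (simp add: real_sqrt_divide real_sqrt_mult field_simps)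
  finally have "has_bochner_integral M (\<lambda>\<omega>. 2 * cmod (herm_prod (X \<omega>) w)) (sqrt (pi * \<eta>) * norm w)"
    using \<open>\<eta> > 0\<close> by (intro has_bochner_integral_nn_integral) auto
  from has_bochner_integral_mult_right[OF this, of "1 / 2"] show ?thesis by simp
qed

lemma circ_gaussian_integrable:
  assumes G: "circ_gaussian M \<eta> X" and "\<eta> > 0"
  shows "integrable M (\<lambda>\<omega>. X \<omega> $ m)"
proof -
  have [measurable]: "X \<in> borel_measurable M"
    using G by (simp add: circ_gaussian_def)
  \<comment> \<open>Projecting on a unit coordinate vector reduces a single coordinate to the mean
    modulus already computed.\<close>
  have "herm_prod (X \<omega>) (axis m 1) = cnj (X \<omega> $ m)" for \<omega>
    by (simp add: herm_prod_def axis_def if_distrib cong: if_cong)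
  then have "integrable M (\<lambda>\<omega>. cmod (X \<omega> $ m))"
    using norm_herm_prod_mean[OF assms, of "axis m 1"] by (simp add: has_bochner_integral_iff)
  then show ?thesis
    by (subst (asm) integrable_norm_iff) auto
qed

lemma circ_gaussian_second_moment:
  assumes G: "circ_gaussian M \<eta> X" and "\<eta> > 0"
  shows "has_bochner_integral M (\<lambda>\<omega>. (cmod (X \<omega> $ m))\<^sup>2) \<eta>"
proof -
  have d: "distributed M lborel (\<lambda>\<omega>. Re (X \<omega> $ m)) (normal_density 0 (sqrt (\<eta> / 2)))"
      "distributed M lborel (\<lambda>\<omega>. Im (X \<omega> $ m)) (normal_density 0 (sqrt (\<eta> / 2)))"
    using G by (auto simp: circ_gaussian_def)
  \<comment> \<open>Index 1 of the even moments is the variance; the real and imaginary parts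
    contribute \<open>\<eta> / 2\<close> each.\<close>
  have sq: "has_bochner_integral M (\<lambda>\<omega>. (Y \<omega>)\<^sup>2) (\<eta> / 2)"
    if Y: "distributed M lborel Y (normal_density 0 (sqrt (\<eta> / 2)))" for Y
    using normal_moment_even[of "sqrt (\<eta> / 2)" 0 1] \<open>\<eta> > 0\<close>
      distributed_integral[OF Y, of "\<lambda>y. y\<^sup>2"] distributed_integrable[OF Y, of "\<lambda>y. y\<^sup>2"]
    by (simp add: has_bochner_integral_iff)
  show ?thesis
    using has_bochner_integral_add[OF sq[OF d(1)] sq[OF d(2)]] by (simp add: cmod_power2)
qed

section \<open>The mean of a Gaussian vector multiplied by the phase of its own projection\<close>

lemma phase_mean:
  assumes G: "circ_gaussian M \<eta> X" and "\<eta> > 0" and "x \<noteq> 0"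
  shows "expectation (\<lambda>\<omega>. X \<omega> $ m * cis (Arg (herm_prod (X \<omega>) x)))
    = (sqrt (pi * \<eta>) / 2 / norm x) *\<^sub>R x $ m"
proof -
  have [measurable]: "X \<in> borel_measurable M"
    using G by (simp add: circ_gaussian_def)
  define c where "c = sqrt (pi * \<eta>) / 2"
  define e where "e \<omega> = cis (Arg (herm_prod (X \<omega>) x))" for \<omega>
  have [measurable]: "e \<in> borel_measurable M"
    unfolding e_def by measurable
  define a where "a = (\<chi> m. expectation (\<lambda>\<omega>. X \<omega> $ m * e \<omega>))"
  have int: "integrable M (\<lambda>\<omega>. X \<omega> $ m * e \<omega>)" for m
    by (rule Bochner_Integration.integrable_bound[OF circ_gaussian_integrable[OF assms(1,2), of m]])
       (auto simp: norm_mult e_def)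
  \<comment> \<open>The Hermitian product is conjugate linear in its first argument, so pulling the
    mean out of it leaves the phase conjugated. The phase stays tied to \<open>x\<close> while
    \<open>y\<close> varies.\<close>
  have hp: "integrable M (\<lambda>\<omega>. cnj (e \<omega>) * herm_prod (X \<omega>) y)"
      "herm_prod a y = expectation (\<lambda>\<omega>. cnj (e \<omega>) * herm_prod (X \<omega>) y)" for y
  proof -
    have *: "cnj (e \<omega>) * herm_prod (X \<omega>) y = (\<Sum>m\<in>UNIV. cnj (X \<omega> $ m * e \<omega>) * y $ m)" for \<omega>
      by (simp add: herm_prod_def sum_distrib_left mult_ac)
    have i: "integrable M (\<lambda>\<omega>. cnj (X \<omega> $ m * e \<omega>) * y $ m)" for m
      by (intro integrable_mult_left integrable_cnj int)
    show "integrable M (\<lambda>\<omega>. cnj (e \<omega>) * herm_prod (X \<omega>) y)"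
      unfolding * by (intro Bochner_Integration.integrable_sum i)
    show "herm_prod a y = expectation (\<lambda>\<omega>. cnj (e \<omega>) * herm_prod (X \<omega>) y)"
      unfolding * using int
      by (subst Bochner_Integration.integral_sum[OF i])
         (simp add: herm_prod_def a_def del: complex_cnj_mult)
  qed
  have inner_a: "inner a y = expectation (\<lambda>\<omega>. Re (cnj (e \<omega>) * herm_prod (X \<omega>) y))" for y
    by (simp add: inner_complex_vec hp(2) integral_Re[OF hp(1)] del: times_complex.sel)
  note mean = norm_herm_prod_mean[OF assms(1,2), folded c_def, unfolded has_bochner_integral_iff]
  have le: "inner a y \<le> c * norm y" for y
  proof -
    have "inner a y \<le> expectation (\<lambda>\<omega>. cmod (herm_prod (X \<omega>) y))"
      unfolding inner_a
    proof (rule integral_mono)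
      fix \<omega>
      show "Re (cnj (e \<omega>) * herm_prod (X \<omega>) y) \<le> cmod (herm_prod (X \<omega>) y)"
        using complex_Re_le_cmod[of "cnj (e \<omega>) * herm_prod (X \<omega>) y"]
        by (simp add: norm_mult e_def del: times_complex.sel)
    qed (use mean hp(1)[of y] in \<open>auto intro!: integrable_Re simp del: times_complex.sel\<close>)
    then show ?thesis using mean by simp
  qed
  \<comment> \<open>At \<open>y = x\<close> the conjugated phase cancels that of the product
    exactly, so the real part is the full modulus.\<close>
  have eq: "inner a x = c * norm x"
  proof -
    have "cnj (cis (Arg z)) * z = of_real (cmod z)" for z
      by (subst (2) rcis_cmod_Arg[of z, symmetric]) (simp add: rcis_def cis_cnj cis_mult)
    then show ?thesis
      using mean[of x] by (simp add: inner_a e_def del: times_complex.sel)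
  qed
  have "c \<ge> 0" using \<open>\<eta> > 0\<close> by (simp add: c_def)
  \<comment> \<open>Testing the bound with \<open>y = a\<close> gives |a|^2 \<le> c |a|.\<close>
  have "norm a \<le> c"
    using le[of a] \<open>c \<ge> 0\<close> by (cases "a = 0") (auto simp: dot_square_norm power2_eq_square)
  then have "(norm a)\<^sup>2 \<le> c\<^sup>2"
    by (simp add: power_mono)
  \<comment> \<open>This is the equality case of Cauchy-Schwarz: for s = c / |x| the last two terms
    are -2c^2 and c^2, leaving |a|^2 - c^2, which is at most 0.\<close>
  moreover have "(norm (a - s *\<^sub>R x))\<^sup>2 = (norm a)\<^sup>2 - 2 * s * inner a x + s\<^sup>2 * (norm x)\<^sup>2" for s
    unfolding power2_norm_eq_inner
    by (simp add: inner_diff_left inner_diff_right inner_commute[of x a] power2_eq_square algebra_simps)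
  from this[of "c / norm x"] have "(norm (a - (c / norm x) *\<^sub>R x))\<^sup>2 = (norm a)\<^sup>2 - c\<^sup>2"
    using \<open>x \<noteq> 0\<close> by (simp add: eq power2_eq_square)
  ultimately have "(norm (a - (c / norm x) *\<^sub>R x))\<^sup>2 \<le> 0" by simp
  then have "a = (c / norm x) *\<^sub>R x" by simp
  then have "a $ m = (c / norm x) *\<^sub>R x $ m" by simp
  then show ?thesis by (simp add: a_def c_def e_def)
qed

section \<open>Freezing one of two independent variables\<close>

lemma expectation_fix_indep:
  fixes f :: "'b \<times> 'b \<Rightarrow> 'c::{banach, second_countable_topology}"
  assumes ind: "indep_var N1 X N2 Y"
    and f [measurable]: "f \<in> borel_measurable (N1 \<Otimes>\<^sub>M N2)"
    and int: "integrable M (\<lambda>\<omega>. f (X \<omega>, Y \<omega>))"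
    and k: "AE \<omega> in M. expectation (\<lambda>\<omega>'. f (X \<omega>', Y \<omega>)) = k"
  shows "expectation (\<lambda>\<omega>. f (X \<omega>, Y \<omega>)) = k"
proof -
  have [measurable]: "X \<in> measurable M N1" "Y \<in> measurable M N2"
    using ind by (auto dest: indep_var_rv1 indep_var_rv2)
  interpret D1: prob_space "distr M N1 X" by (rule prob_space_distr) simp
  interpret D2: prob_space "distr M N2 Y" by (rule prob_space_distr) simp
  interpret P: pair_sigma_finite "distr M N1 X" "distr M N2 Y" ..
  \<comment> \<open>Independence makes the joint law a product, so Fubini allows integrating over
    \<open>X\<close> first with \<open>Y\<close> held at a value. That inner integral only has to
    equal \<open>k\<close> almost surely, which later leaves room for the null event that the
    channel vector vanishes.\<close>
  have D: "distr M (N1 \<Otimes>\<^sub>M N2) (\<lambda>\<omega>. (X \<omega>, Y \<omega>)) = distr M N1 X \<Otimes>\<^sub>M distr M N2 Y"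
    using ind by (simp add: indep_var_distribution_eq)
  have int': "integrable (distr M N1 X \<Otimes>\<^sub>M distr M N2 Y) f"
    unfolding D[symmetric] by (subst integrable_distr_eq) (auto simp: int)
  have "expectation (\<lambda>\<omega>. f (X \<omega>, Y \<omega>)) = integral\<^sup>L (distr M N1 X \<Otimes>\<^sub>M distr M N2 Y) f"
    unfolding D[symmetric] by (subst integral_distr) auto
  also have "\<dots> = (\<integral>y. \<integral>x. f (x, y) \<partial>distr M N1 X \<partial>distr M N2 Y)"
    using P.integral_snd[of "\<lambda>x y. f (x, y)"] int' by simp
  also have "\<dots> = expectation (\<lambda>\<omega>. \<integral>x. f (x, Y \<omega>) \<partial>distr M N1 X)"
    by (subst integral_distr) auto
  also have "\<dots> = expectation (\<lambda>\<omega>. k)"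
  proof (rule integral_cong_AE)
    show "AE \<omega> in M. (\<integral>x. f (x, Y \<omega>) \<partial>distr M N1 X) = k"
      using k AE_space
    proof eventually_elim
      case (elim \<omega>)
      then have "Y \<omega> \<in> space N2" using measurable_space[OF \<open>Y \<in> measurable M N2\<close>] by simp
      with elim show ?case by (subst integral_distr) auto
    qed
  qed auto
  also have "\<dots> = k" by (simp add: prob_space)
  finally show ?thesis .
qed

text \<open>For fixed \<open>x\<close> each phase factor depends on one of the two vectors only and
  can be absorbed into it. Coordinate by coordinate independence then yields a product of means
  known from \<open>phase_mean\<close>, and the sum is the squared norm of a vector of length
  sqrt(pi \<eta>) / 2.\<close>

lemma indep_circ_gaussian_mean:
  fixes X Y :: "'a \<Rightarrow> complex ^ 'n"
  assumes X: "circ_gaussian M \<eta> X" and Y: "circ_gaussian M \<eta> Y" and "\<eta> > 0"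
    and ind: "indep_var borel X borel Y" and "x \<noteq> 0"
  shows "expectation (\<lambda>\<omega>. herm_prod (X \<omega>) (Y \<omega>) *
      (cnj (cis (Arg (herm_prod (X \<omega>) x))) * cis (Arg (herm_prod (Y \<omega>) x)))) = complex_of_real (pi * \<eta> / 4)"
proof -
  define F where "F m u = u $ m * cis (Arg (herm_prod u x))" for m and u :: "complex ^ 'n"
  have [measurable]: "F m \<in> borel_measurable borel" for m
    unfolding F_def by measurable
  have [measurable]: "X \<in> borel_measurable M" "Y \<in> borel_measurable M"
    using X Y by (auto simp: circ_gaussian_def)
  have int: "integrable M (\<lambda>\<omega>. F m (Z \<omega>))" if "circ_gaussian M \<eta> Z" for m Z
  proof -
    have [measurable]: "Z \<in> borel_measurable M"
      using that by (auto simp: circ_gaussian_def)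
    show ?thesis
      by (rule Bochner_Integration.integrable_bound[OF circ_gaussian_integrable[OF that \<open>\<eta> > 0\<close>, of m]])
         (auto simp: F_def norm_mult)
  qed
  have ind': "indep_var borel (\<lambda>\<omega>. cnj (F m (X \<omega>))) borel (\<lambda>\<omega>. F m (Y \<omega>))" for m
    using indep_var_compose[OF ind, of "\<lambda>u. cnj (F m u)" borel "F m" borel] by (simp add: comp_def)
  have "expectation (\<lambda>\<omega>. herm_prod (X \<omega>) (Y \<omega>) *
      (cnj (cis (Arg (herm_prod (X \<omega>) x))) * cis (Arg (herm_prod (Y \<omega>) x))))
    = expectation (\<lambda>\<omega>. \<Sum>m\<in>UNIV. cnj (F m (X \<omega>)) * F m (Y \<omega>))"
    by (simp add: herm_prod_def F_def sum_distrib_left sum_distrib_right mult_ac)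
  also have "\<dots> = (\<Sum>m\<in>UNIV. cnj (expectation (\<lambda>\<omega>. F m (X \<omega>))) * expectation (\<lambda>\<omega>. F m (Y \<omega>)))"
    using indep_var_lebesgue_integral[OF ind'] indep_var_integrable[OF ind'] int[OF X] int[OF Y]
    by (subst Bochner_Integration.integral_sum) auto
  also have "\<dots> = (\<Sum>m\<in>UNIV. complex_of_real ((sqrt (pi * \<eta>) / 2 / norm x)\<^sup>2 * (cmod (x $ m))\<^sup>2))"
  proof (rule sum.cong)
    have "cnj (r *\<^sub>R z) * (r *\<^sub>R z) = complex_of_real (r\<^sup>2 * (cmod z)\<^sup>2)" for r z
      using complex_norm_square[of z] by (simp add: scaleR_conv_of_real power2_eq_square mult_ac)
    then show "cnj (expectation (\<lambda>\<omega>. F m (X \<omega>))) * expectation (\<lambda>\<omega>. F m (Y \<omega>))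
        = complex_of_real ((sqrt (pi * \<eta>) / 2 / norm x)\<^sup>2 * (cmod (x $ m))\<^sup>2)" for m
      by (simp only: F_def phase_mean[OF X \<open>\<eta> > 0\<close> \<open>x \<noteq> 0\<close>] phase_mean[OF Y \<open>\<eta> > 0\<close> \<open>x \<noteq> 0\<close>])
  qed simp
  also have "\<dots> = complex_of_real ((sqrt (pi * \<eta>) / 2 / norm x)\<^sup>2 * (norm x)\<^sup>2)"
    by (simp only: norm_vec_power2 sum_distrib_left of_real_sum)
  also have "(sqrt (pi * \<eta>) / 2 / norm x)\<^sup>2 * (norm x)\<^sup>2 = pi * \<eta> / 4"
    using \<open>x \<noteq> 0\<close> \<open>\<eta> > 0\<close> by (simp add: power_divide)
  finally show ?thesis .
qed

lemma indep_circ_gaussian_integrable: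
  fixes X Y :: "'a \<Rightarrow> complex ^ 'n"
  assumes X: "circ_gaussian M \<eta> X" and Y: "circ_gaussian M \<eta> Y" and "\<eta> > 0"
    and ind: "indep_var borel X borel Y"
  shows "integrable M (\<lambda>\<omega>. herm_prod (X \<omega>) (Y \<omega>))"
  unfolding herm_prod_def
proof (rule Bochner_Integration.integrable_sum)
  fix m
  have "indep_var borel (\<lambda>\<omega>. cnj (X \<omega> $ m)) borel (\<lambda>\<omega>. Y \<omega> $ m)"
    using indep_var_compose[OF ind, of "\<lambda>u. cnj (u $ m)" borel "\<lambda>u. u $ m" borel]
    by (simp add: comp_def)
  then show "integrable M (\<lambda>\<omega>. cnj (X \<omega> $ m) * Y \<omega> $ m)"
    using circ_gaussian_integrable[OF X \<open>\<eta> > 0\<close>] circ_gaussian_integrable[OF Y \<open>\<eta> > 0\<close>]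
    by (intro indep_var_integrable) auto
qed

end

section \<open>The coincident and the independent case\<close>

theorem theorem1:
  fixes M :: "'a measure"
    and g :: "'i \<Rightarrow> 'a \<Rightarrow> complex ^ 'n"
    and h :: "'k \<Rightarrow> 'a \<Rightarrow> complex ^ 'n"
    and i j :: 'i and k :: 'k
    and \<eta> :: real
    and \<phi>\<^sub>1 \<phi>\<^sub>2 :: "'a \<Rightarrow> real"
  assumes "prob_space M"
    and "\<eta> > 0"
    and "circ_gaussian M \<eta> (g i)"
    and "circ_gaussian M \<eta> (g j)"
    and "h k \<in> borel_measurable M"
    and "AE \<omega> in M. h k \<omega> \<noteq> 0"
    and "i \<noteq> j \<Longrightarrow>
      prob_space.indep_vars M (\<lambda>_. borel) (case_sum g h) {Inl i, Inl j, Inr k}"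
    and "i = j \<Longrightarrow> prob_space.indep_var M borel (g i) borel (h k)"
    and "\<And>\<omega>. \<phi>\<^sub>1 \<omega> = Arg (herm_prod (g j \<omega>) (h k \<omega>))"
    and "\<And>\<omega>. \<phi>\<^sub>2 \<omega> = Arg (herm_prod (g i \<omega>) (h k \<omega>))"
  shows "prob_space.expectation M
      (\<lambda>\<omega>. herm_prod (g i \<omega>) (g j \<omega>) * exp (\<i> * complex_of_real (\<phi>\<^sub>1 \<omega> - \<phi>\<^sub>2 \<omega>))) =
    (if i = j then complex_of_real (\<eta> * real CARD('n)) else complex_of_real (pi * \<eta> / 4))"
proof -
  interpret prob_space M by fact
  show ?thesis
  proof (cases "i = j")
    case True
    \<comment> \<open>For \<open>i = j\<close> the two phases agree, the exponential is 1, and the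
      mean of the squared norm of \<open>g i\<close> remains.\<close>
    have "herm_prod u u = complex_of_real (\<Sum>m\<in>UNIV. (cmod (u $ m))\<^sup>2)" for u :: "complex ^ 'n"
      by (simp add: herm_prod_def complex_norm_square mult.commute del: of_real_power)
    moreover have "has_bochner_integral M (\<lambda>\<omega>. \<Sum>m\<in>UNIV. (cmod (g i \<omega> $ m))\<^sup>2) (\<Sum>m\<in>(UNIV :: 'n set). \<eta>)"
      by (intro has_bochner_integral_sum circ_gaussian_second_moment assms)
    ultimately show ?thesis
      using True assms(9,10) by (simp add: has_bochner_integral_iff mult.commute del: of_real_sum of_real_power)
  next
    case False
    let ?I = "{Inl i, Inl j}" and ?K = "{Inr k}"
    have gm [measurable]: "g i \<in> borel_measurable M" "g j \<in> borel_measurable M" "h k \<in> borel_measurable M"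
      using assms(3-5) by (auto simp: circ_gaussian_def)
    have ind: "indep_vars (\<lambda>_. borel) (case_sum g h) {Inl i, Inl j, Inr k}"
      using assms(7) False by simp
    \<comment> \<open>Independence of \<open>g i\<close> and \<open>g j\<close> comes from grouping
      the family into two singletons and evaluating each at its index.\<close>
    have "indep_var (PiM {Inl i} (\<lambda>_. borel)) (\<lambda>\<omega>. restrict (\<lambda>l. case_sum g h l \<omega>) {Inl i})
        (PiM {Inl j} (\<lambda>_. borel)) (\<lambda>\<omega>. restrict (\<lambda>l. case_sum g h l \<omega>) {Inl j})"
      using False by (intro indep_var_restrict[OF ind]) auto
    then have ij: "indep_var borel (g i) borel (g j)"
      using indep_var_compose[of _ _ _ _ "\<lambda>p. p (Inl i)" borel "\<lambda>p. p (Inl j)" borel]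
      by (fastforce simp: comp_def)
    \<comment> \<open>\<open>indep_var\<close> takes two variables of one type, so the pair of
      Gaussian vectors and the single \<open>h k\<close> are both encoded as functions on the sum of
      the index types, restricted to disjoint blocks.\<close>
    define G where "G \<omega> = restrict (\<lambda>l. case_sum g h l \<omega>) ?I" for \<omega>
    define H where "H \<omega> = restrict (\<lambda>l. case_sum g h l \<omega>) ?K" for \<omega>
    have GH: "indep_var (PiM ?I (\<lambda>_. borel)) G (PiM ?K (\<lambda>_. borel)) H"
      unfolding G_def H_def by (intro indep_var_restrict[OF ind]) auto
    define f where "f u v x = herm_prod u v *
      (cnj (cis (Arg (herm_prod u x))) * cis (Arg (herm_prod v x)))" for u v x :: "complex ^ 'n"
    define F where "F = (\<lambda>(p, q). f (p (Inl i :: 'i + 'k)) (p (Inl j)) (q (Inr k :: 'i + 'k)))"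
    have F [measurable]: "F \<in> borel_measurable (PiM ?I (\<lambda>_. borel) \<Otimes>\<^sub>M PiM ?K (\<lambda>_. borel))"
      unfolding F_def f_def by measurable
    have FGH: "F (G \<omega>, H \<omega>') = herm_prod (g i \<omega>) (g j \<omega>) *
      (cnj (cis (Arg (herm_prod (g i \<omega>) (h k \<omega>')))) * cis (Arg (herm_prod (g j \<omega>) (h k \<omega>'))))" for \<omega> \<omega>'
      by (simp add: F_def f_def G_def H_def)
    have "expectation (\<lambda>\<omega>. F (G \<omega>, H \<omega>)) = complex_of_real (pi * \<eta> / 4)"
    proof (rule expectation_fix_indep[OF GH F])
      \<comment> \<open>The phase factors have modulus 1, so the plain Hermitian product
        dominates.\<close>
      show "integrable M (\<lambda>\<omega>. F (G \<omega>, H \<omega>))"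
        unfolding FGH
        by (rule Bochner_Integration.integrable_bound[OF indep_circ_gaussian_integrable[OF assms(3,4,2) ij]])
           (auto simp: norm_mult)
      show "AE \<omega> in M. expectation (\<lambda>\<omega>'. F (G \<omega>', H \<omega>)) = complex_of_real (pi * \<eta> / 4)"
        using assms(6) unfolding FGH
        by eventually_elim (rule indep_circ_gaussian_mean[OF assms(3,4,2) ij])
    qed
    moreover have "exp (\<i> * complex_of_real (\<phi>\<^sub>1 \<omega> - \<phi>\<^sub>2 \<omega>)) = cnj (cis (\<phi>\<^sub>2 \<omega>)) * cis (\<phi>\<^sub>1 \<omega>)" for \<omega>
      by (simp add: cis_conv_exp[symmetric] cis_cnj cis_mult del: of_real_diff)
    ultimately show ?thesis
      using False by (simp add: FGH assms(9,10))
  qed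
qed

end
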